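(* Let $N\in\mathbb{N}^*$, $\sigma>0$, and let $W$ be an $N\times N$ random matrix with i.i.d. $\mathcal{N}(0,\sigma^2)$ entries. For $T\in\mathbb{N}^*$ let $B_{T,N}$ be its generalised matrix of moments of order $T$, with eigenvalues $\lambda_T(B_{T,N})\le\cdots\le\lambda_0(B_{T,N})=\lambda_{\max}(B_{T,N})$. Then for all $T\in\mathbb{N}^*$, \[\frac1{P(T)}\le\frac{\lambda_{\max}(B_{T,N})}{\sum_{i=0}^T\lambda_i(B_{T,N})}\le1,\qquad P(T)=\min\Big(T+1,\sum_{l=0}^T(\sigma^2N)^{-l}\Big).\] Moreover, there exists $T_{\sigma,N}\ge 6$ such that for all $T\ge T_{\sigma,N}$, \[\frac1{Q(T)}\le\frac{\lambda_{\max}(B_{T,N})}{\sum_{i=0}^T\lambda_i(B_{T,N})},\quad Q(T):=\min\Big(2,1+\frac1{\sigma^2N}\Big)\left(1+\frac{1}{2\left(\frac{\sigma^2}{N}\right)^2(T-3)}+\frac{T}{8\left(\frac{\sigma^2}{N}\right)^4(T-5)^2}\right).\]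
   Context: Generalised matrix of moments: for $i\in[N]$, $\beta_{i,0}=1$, $\beta_{i,l}=\sum_{i_1,\ldots,i_l=1}^N W_{ii_1}\cdots W_{i_{l-1}i_l}$ for $l\ge1$, and $B_{T,N}(l_1,l_2)=\mathbb{E}\sum_{i=1}^N\beta_{i,l_1}\beta_{i,l_2}$, $0\le l_1,l_2\le T$. *)

theory Defs
  imports "HOL-Probability.Probability" "Jordan_Normal_Form.Char_Poly"
begin

text \<open>Law of an N x N random matrix with i.i.d. centred Gaussian entries of variance
  sigma^2 (normal_density 0 sigma has standard deviation sigma). Indices are 0..N-1.\<close>
definition gauss_matrix_measure :: "nat \<Rightarrow> real \<Rightarrow> (nat \<times> nat \<Rightarrow> real) measure" where
  "gauss_matrix_measure N \<sigma> =
     PiM ({..<N} \<times> {..<N}) (\<lambda>_. density lborel (normal_density 0 \<sigma>))"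

text \<open>beta_{i,l} = sum over i_1..i_l in [N] of W_{i i_1} W_{i_1 i_2} ... W_{i_{l-1} i_l};
  the tuple (i_1,...,i_l) is encoded as p with p k = i_{k+1}. For l = 0 this is 1.\<close>
definition beta :: "nat \<Rightarrow> (nat \<times> nat \<Rightarrow> real) \<Rightarrow> nat \<Rightarrow> nat \<Rightarrow> real" where
  "beta N W i l =
     (\<Sum>p \<in> Pi\<^sub>E {..<l} (\<lambda>_. {..<N}).
        \<Prod>k<l. W (if k = 0 then i else p (k - 1), p k))"

definition moment_matrix :: "nat \<Rightarrow> real \<Rightarrow> nat \<Rightarrow> real mat" where
  "moment_matrix N \<sigma> T =
     mat (T + 1) (T + 1)
       (\<lambda>(l1, l2). integral\<^sup>L (gauss_matrix_measure N \<sigma>)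
                     (\<lambda>W. \<Sum>i<N. beta N W i l1 * beta N W i l2))"

definition sorted_eigenvalues :: "real mat \<Rightarrow> real list \<Rightarrow> bool" where
  "sorted_eigenvalues A lams \<longleftrightarrow>
     length lams = dim_row A \<and> sorted (rev lams) \<and>
     char_poly A = prod_list (map (\<lambda>x. [:- x, 1:]) lams)"

definition P_bound :: "real \<Rightarrow> nat \<Rightarrow> nat \<Rightarrow> real" where
  "P_bound \<sigma> N T = min (real T + 1) (\<Sum>l\<le>T. (\<sigma>^2 * real N) powi (- int l))"

definition Q_bound :: "real \<Rightarrow> nat \<Rightarrow> nat \<Rightarrow> real" where
  "Q_bound \<sigma> N T =
     min 2 (1 + 1 / (\<sigma>^2 * real N)) *
     (1 + 1 / (2 * (\<sigma>^2 / real N)^2 * (real T - 3))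
        + real T / (8 * (\<sigma>^2 / real N)^4 * (real T - 5)^2))"

end

theory Submission
  imports Defs "Jordan_Normal_Form.Schur_Decomposition"
begin

text \<open>
  Write \<open>b\<^sub>l\<close> for the diagonal entry \<open>B(l,l)\<close>. Every \<open>\<beta>\<^bsub>i,l\<^esub>\<close> is a homogeneous polynomial
  with nonnegative coefficients in the Gaussian entries, and such polynomials have nonnegative
  expectation, so lower bounds on \<open>b\<^sub>l\<close> follow by discarding pairs of paths. Keeping the pairs that
  start with the same edge gives \<open>b\<^bsub>l+1\<^esub> \<ge> \<sigma>\<^sup>2N b\<^sub>l\<close>. Keeping the pairs that share their first two
  edges, and summing over all choices of the first edge by means of
  \<open>\<Sum>\<^sub>e E[W\<^sub>e\<^sup>2 f] = \<sigma>\<^sup>2(N\<^sup>2 + deg f) E f\<close>, gives \<open>b\<^bsub>l+2\<^esub> \<ge> \<sigma>\<^sup>4(N\<^sup>2 + 2l) b\<^sub>l\<close>.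
  Since \<open>B\<close> is symmetric and positive semidefinite, its largest eigenvalue dominates the diagonal,
  in particular \<open>b\<^sub>T\<close> and \<open>b\<^bsub>T-1\<^esub>\<close>, while the sum of the eigenvalues is \<open>\<Sum>\<^sub>l b\<^sub>l\<close>. The one-step growth
  bounds this sum by a geometric one; grouping consecutive terms in pairs and using the two-step
  growth gives the bound for large \<open>T\<close>.
\<close>

section \<open>Eigenvalues of positive semidefinite matrices\<close>

definition tr :: "real mat \<Rightarrow> real" where
  "tr A = (\<Sum>i<dim_row A. A $$ (i, i))"

lemma mat_mult_entry_sum:
  assumes "A \<in> carrier_mat n n" "B \<in> carrier_mat n n" "i < n" "j < n"
  shows "(A * B) $$ (i, j) = (\<Sum>k<n. A $$ (i, k) * B $$ (k, j))"
  using assms by (auto simp: scalar_prod_def lessThan_atLeast0 intro!: sum.cong)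

lemma tr_mult_commute:
  assumes A: "A \<in> carrier_mat n n" and B: "B \<in> carrier_mat n n"
  shows "tr (A * B) = tr (B * A)"
proof -
  have "tr (A * B) = (\<Sum>i<n. \<Sum>k<n. A $$ (i, k) * B $$ (k, i))"
    using A unfolding tr_def by (auto intro!: sum.cong mat_mult_entry_sum[OF A B] simp del: index_mult_mat(1))
  also have "\<dots> = (\<Sum>k<n. \<Sum>i<n. A $$ (i, k) * B $$ (k, i))"
    by (rule sum.swap)
  also have "\<dots> = tr (B * A)"
    using B unfolding tr_def
    by (auto intro!: sum.cong simp: mat_mult_entry_sum[OF B A] mult.commute simp del: index_mult_mat(1))
  finally show ?thesis .
qed

lemma triangularization:
  fixes A :: "real mat"
  assumes A: "A \<in> carrier_mat n n" and c: "char_poly A = prod_list (map (\<lambda>x. [:- x, 1:]) es)"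
  obtains C P Q where "similar_mat_wit A C P Q" "upper_triangular C" "diag_mat C = es"
  using schur_decomposition[OF A c] by (metis prod_cases3)

text \<open>The trace is invariant under similarity, and the diagonal of the triangular form is
  exactly \<open>es\<close>.\<close>

lemma sum_eigenvalues_eq_tr:
  assumes A: "A \<in> carrier_mat n n" and c: "char_poly A = prod_list (map (\<lambda>x. [:- x, 1:]) es)"
  shows "sum_list es = tr A"
proof -
  obtain C P Q where w: "similar_mat_wit A C P Q" and C: "diag_mat C = es"
    using triangularization[OF A c] by blast
  note D = similar_mat_witD2[OF A w]
  have "tr A = tr (P * (C * Q))" using D by simp
  also have "\<dots> = tr (C * Q * P)" using D by (intro tr_mult_commute[of _ n]) auto
  also have "C * Q * P = C" using D by (metis assoc_mult_mat right_mult_one_mat)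
  also have "tr C = sum_list es"
    unfolding C[symmetric] diag_mat_def tr_def
    by (simp add: sum_list_sum_nth lessThan_atLeast0)
  finally show ?thesis by simp
qed

text \<open>The similarity that triangularises \<open>A\<close> also triangularises
  \<open>A * A\<close>, and squaring a triangular matrix squares its diagonal entries, so
  multiplicities are kept.\<close>

lemma char_poly_square:
  fixes A :: "real mat"
  assumes A: "A \<in> carrier_mat n n" and c: "char_poly A = prod_list (map (\<lambda>x. [:- x, 1:]) es)"
  shows "char_poly (A * A) = prod_list (map (\<lambda>x. [:- x, 1:]) (map (\<lambda>x. x\<^sup>2) es))"
proof -
  obtain C P Q where w: "similar_mat_wit A C P Q" and ut: "upper_triangular C"
    and dC: "diag_mat C = es"
    using triangularization[OF A c] by blast
  note D = similar_mat_witD2[OF A w]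
  have C: "C \<in> carrier_mat n n" by fact
  have "A * A = P * (C * (Q * P) * C) * Q"
    unfolding D(3) using D(5-7) by (simp add: assoc_mult_mat[of _ n n _ n _ n])
  then have eq: "A * A = P * (C * C) * Q" using D by simp
  have "similar_mat_wit (A * A) (C * C) P Q"
    by (rule similar_mat_witI[OF D(1,2) eq]) (use D in auto)
  then have "char_poly (A * A) = char_poly (C * C)"
    by (intro char_poly_similar) (auto simp: similar_mat_def)
  moreover
  have zero: "C $$ (i, k) * C $$ (k, j) = 0" if "i < n" "k < n" "j < i" for i j k
    using upper_triangularD[OF ut, of k i] upper_triangularD[OF ut, of j k] that C
    by (cases "k < i") auto
  have "upper_triangular (C * C)"
    using C zero
    by (intro upper_triangularI)
      (auto simp: mat_mult_entry_sum[OF C C] simp del: index_mult_mat(1) mult_eq_0_iff intro!: sum.neutral)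
  then have "char_poly (C * C) = prod_list (map (\<lambda>x. [:- x, 1:]) (diag_mat (C * C)))"
    using C by (intro char_poly_upper_triangular[of _ n]) auto
  moreover have "(C * C) $$ (i, i) = (C $$ (i, i))\<^sup>2" if i: "i < n" for i
  proof -
    have "(C * C) $$ (i, i) = (\<Sum>k<n. C $$ (i, k) * C $$ (k, i))"
      by (rule mat_mult_entry_sum[OF C C i i])
    also have "\<dots> = (\<Sum>k<n. if k = i then (C $$ (i, i))\<^sup>2 else 0)"
      using upper_triangularD[OF ut] i C
      by (intro sum.cong) (auto simp: power2_eq_square, metis carrier_matD(1) nat_neq_iff)
    finally show ?thesis using i by simp
  qed
  then have "diag_mat (C * C) = map (\<lambda>x. x\<^sup>2) es"
    unfolding dC[symmetric] diag_mat_def using C by simp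
  ultimately show ?thesis by simp
qed

text \<open>Repeated squaring: after taking \<open>2^k\<close>-th roots and letting \<open>k\<close> tend to infinity this bounds
  the diagonal by the spectral radius, which avoids an orthogonal diagonalisation.\<close>
lemma diag_power_le_sum_eigenvalue_powers:
  fixes A :: "real mat"
  assumes "A \<in> carrier_mat n n" "char_poly A = prod_list (map (\<lambda>x. [:- x, 1:]) es)"
    "\<And>i j. i < n \<Longrightarrow> j < n \<Longrightarrow> A $$ (i, j) = A $$ (j, i)" "\<And>i. i < n \<Longrightarrow> 0 \<le> A $$ (i, i)" "j < n"
  shows "(A $$ (j, j)) ^ (2 ^ k) \<le> (\<Sum>x\<leftarrow>es. x ^ (2 ^ k))"
  using assms
proof (induction k arbitrary: A es)
  case 0
  have "A $$ (j, j) \<le> tr A"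
    using 0 unfolding tr_def by (intro member_le_sum) auto
  then show ?case using sum_eigenvalues_eq_tr[OF 0(1,2)] by simp
next
  case (Suc k)
  note A = Suc.prems(1)
  have sq: "(A * A) $$ (i, l) = (\<Sum>m<n. A $$ (i, m) * A $$ (l, m))" if "i < n" "l < n" for i l
    using mat_mult_entry_sum[OF A A that] Suc.prems(3) that by (auto intro!: sum.cong)
  have "(A $$ (j, j))\<^sup>2 \<le> (\<Sum>m<n. (A $$ (j, m))\<^sup>2)"
    using \<open>j < n\<close> by (intro member_le_sum[of j _ "\<lambda>m. (A $$ (j, m))\<^sup>2"]) auto
  also have "\<dots> = (A * A) $$ (j, j)"
    using \<open>j < n\<close> by (simp only: sq power2_eq_square)
  finally have "((A $$ (j, j))\<^sup>2) ^ (2 ^ k) \<le> ((A * A) $$ (j, j)) ^ (2 ^ k)"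
    by (intro power_mono) auto
  \<comment> \<open>By symmetry the diagonal of \<open>A * A\<close> consists of sums of squares, so
    the hypotheses pass to \<open>A * A\<close> with the squared eigenvalues.\<close>
  also have "\<dots> \<le> (\<Sum>x\<leftarrow>map (\<lambda>x. x\<^sup>2) es. x ^ (2 ^ k))"
  proof (rule Suc.IH)
    show "A * A \<in> carrier_mat n n" using A by auto
    show "char_poly (A * A) = prod_list (map (\<lambda>x. [:- x, 1:]) (map (\<lambda>x. x\<^sup>2) es))"
      by (rule char_poly_square[OF A Suc.prems(2)])
  qed (use \<open>j < n\<close> in \<open>auto simp: sq mult.commute intro!: sum_nonneg simp del: index_mult_mat(1)\<close>)
  finally show ?case by (simp add: power_mult[symmetric] o_def)
qed

text \<open>If \<open>a\<close> exceeded a positive \<open>r\<close>, the powers of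
  \<open>a / r\<close> would outgrow the constant \<open>c\<close>; for \<open>r = 0\<close> the
  case \<open>k = 0\<close> suffices.\<close>

lemma power_doubling_le_imp_le:
  fixes a c r :: real
  assumes r: "0 \<le> r" and h: "\<And>k::nat. a ^ (2 ^ k) \<le> c * r ^ (2 ^ k)"
  shows "a \<le> r"
proof (rule ccontr)
  assume "\<not> a \<le> r"
  show False
  proof (cases "r = 0")
    case True
    then show False using h[of 0] \<open>\<not> a \<le> r\<close> by simp
  next
    case False
    then have q: "a / r > 1" using \<open>\<not> a \<le> r\<close> r by simp
    obtain k where k: "c < (a / r) ^ k" using real_arch_pow[OF q] by blast
    have "(a / r) ^ k \<le> (a / r) ^ (2 ^ k)"
      using q by (intro power_increasing) auto
    moreover have "(a / r) ^ (2 ^ k) \<le> c"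
      using h[of k] r False by (simp add: power_divide divide_le_eq)
    ultimately show False using k by simp
  qed
qed

text \<open>Semidefiniteness is stated through test functions \<open>v\<close> on indices, which
  turns the quadratic form into plain double sums. Since \<open>n > 0\<close>, the entry
  \<open>lams ! 0\<close> exists and is the largest eigenvalue.\<close>

locale psd_eigenvalues =
  fixes A :: "real mat" and n :: nat and lams :: "real list"
  assumes A: "A \<in> carrier_mat n n"
    and n: "n > 0"
    and sym: "\<And>i j. i < n \<Longrightarrow> j < n \<Longrightarrow> A $$ (i, j) = A $$ (j, i)"
    and psd: "\<And>v. 0 \<le> (\<Sum>i<n. \<Sum>j<n. A $$ (i, j) * v i * v j)"
    and lams: "sorted_eigenvalues A lams"
begin

lemma len: "length lams = n" using lams A unfolding sorted_eigenvalues_def by auto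

lemma char_poly_eq: "char_poly A = prod_list (map (\<lambda>x. [:- x, 1:]) lams)"
  using lams unfolding sorted_eigenvalues_def by auto

lemma le_max: "x \<in> set lams \<Longrightarrow> x \<le> lams ! 0"
  using lams unfolding sorted_eigenvalues_def
  by (metis in_set_conv_nth sorted_rev_nth_mono le0)

lemma sum_lams: "sum_list lams = (\<Sum>i<n. A $$ (i, i))"
  using sum_eigenvalues_eq_tr[OF A char_poly_eq] A unfolding tr_def by simp

text \<open>On an eigenvector the quadratic form equals \<open>x\<close> times the squared norm,
  which is positive.\<close>

lemma eigenvalue_nonneg:
  assumes x: "x \<in> set lams"
  shows "0 \<le> x"
proof -
  have "poly (char_poly A) x = 0"
    unfolding char_poly_eq using x by (simp add: poly_prod_list prod_list_zero_iff o_def image_iff)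
  then have "eigenvalue A x" using eigenvalue_root_char_poly[OF A] by simp
  then obtain v where v: "v \<in> carrier_vec n" "v \<noteq> 0\<^sub>v n" "A *\<^sub>v v = x \<cdot>\<^sub>v v"
    using A unfolding eigenvalue_def eigenvector_def by auto
  define w where "w = vec_index v"
  have row: "(\<Sum>j<n. A $$ (i, j) * w j) = x * w i" if i: "i < n" for i
  proof -
    have "(\<Sum>j<n. A $$ (i, j) * w j) = vec_index (A *\<^sub>v v) i"
      using A v(1) i by (auto simp: w_def scalar_prod_def lessThan_atLeast0 intro!: sum.cong)
    then show ?thesis using v i by (simp add: w_def)
  qed
  have "(\<Sum>i<n. \<Sum>j<n. A $$ (i, j) * w i * w j) = (\<Sum>i<n. w i * (\<Sum>j<n. A $$ (i, j) * w j))"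
    by (simp add: sum_distrib_left mult_ac)
  also have "\<dots> = (\<Sum>i<n. w i * (x * w i))"
    by (simp add: row)
  also have "\<dots> = x * (\<Sum>i<n. (w i)\<^sup>2)"
    by (simp add: sum_distrib_left power2_eq_square mult_ac)
  finally have ge: "0 \<le> x * (\<Sum>i<n. (w i)\<^sup>2)" using psd[of w] by simp
  obtain i where i: "i < n" "w i \<noteq> 0"
    using v(1,2) unfolding w_def by (metis carrier_vecD eq_vecI index_zero_vec)
  then have "0 < (w i)\<^sup>2" by simp
  also have "(w i)\<^sup>2 \<le> (\<Sum>i<n. (w i)\<^sup>2)"
    using i by (intro member_le_sum[of i _ "\<lambda>m. (w m)\<^sup>2"]) auto
  finally show ?thesis using ge by (simp add: zero_le_mult_iff)
qed

lemma diag_nonneg: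
  assumes i: "i < n"
  shows "0 \<le> A $$ (i, i)"
proof -
  let ?v = "\<lambda>k. if k = i then 1 else 0 :: real"
  have "(\<Sum>k<n. \<Sum>j<n. A $$ (k, j) * ?v k * ?v j) = (\<Sum>k<n. if k = i then A $$ (i, i) else 0)"
    using i by (intro sum.cong) (auto simp: sum.delta' if_distrib[of "\<lambda>x. _ * x"] cong: if_cong)
  then show ?thesis using psd[of ?v] i by simp
qed

lemma max_nonneg: "0 \<le> lams ! 0"
  using eigenvalue_nonneg[of "lams ! 0"] len n by simp

text \<open>All eigenvalues lie between 0 and \<open>lams ! 0\<close>, so the sum of their powers is
  at most \<open>n\<close> times the power of the largest; the factor \<open>n\<close> disappears
  under repeated squaring.\<close>

lemma diag_le_max:
  assumes j: "j < n"
  shows "A $$ (j, j) \<le> lams ! 0"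
proof (rule power_doubling_le_imp_le[OF max_nonneg])
  fix k :: nat
  have "(A $$ (j, j)) ^ (2 ^ k) \<le> (\<Sum>x\<leftarrow>lams. x ^ (2 ^ k))"
    by (rule diag_power_le_sum_eigenvalue_powers[OF A char_poly_eq sym diag_nonneg j])
  also have "\<dots> \<le> (\<Sum>x\<leftarrow>lams. (lams ! 0) ^ (2 ^ k))"
    by (intro sum_list_mono power_mono le_max eigenvalue_nonneg)
  also have "\<dots> = real n * (lams ! 0) ^ (2 ^ k)" by (simp add: sum_list_triv len)
  finally show "(A $$ (j, j)) ^ (2 ^ k) \<le> real n * (lams ! 0) ^ (2 ^ k)" .
qed

lemma max_le_sum: "lams ! 0 \<le> sum_list lams"
  using len n eigenvalue_nonneg by (intro member_le_sum_list) auto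

lemma sum_le_card_max: "sum_list lams \<le> real n * lams ! 0"
proof -
  have "sum_list lams \<le> (\<Sum>x\<leftarrow>lams. lams ! 0)"
    using sum_list_mono[of lams "\<lambda>x. x" "\<lambda>_. lams ! 0"] le_max by simp
  then show ?thesis by (simp add: sum_list_triv len)
qed

end

section \<open>Gaussian moments of polynomials with nonnegative coefficients\<close>

definition gauss_moment :: "real \<Rightarrow> nat \<Rightarrow> real" where
  "gauss_moment \<sigma> k = (\<integral>x. x ^ k \<partial>density lborel (normal_density 0 \<sigma>))"

lemma integrable_gauss_power:
  assumes "\<sigma> > 0"
  shows "integrable (density lborel (normal_density 0 \<sigma>)) (\<lambda>x. x ^ k :: real)"
  using integrable_normal_moment[OF assms, of 0 k]
  by (subst integrable_density) auto

lemma gauss_moment_altdef: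
  assumes "\<sigma> > 0"
  shows "gauss_moment \<sigma> k = (\<integral>x. normal_density 0 \<sigma> x * x ^ k \<partial>lborel)"
  unfolding gauss_moment_def by (subst integral_density) auto

lemma gauss_moment_even:
  assumes "\<sigma> > 0"
  shows "gauss_moment \<sigma> (2 * k) = fact (2 * k) / ((2 / \<sigma>\<^sup>2) ^ k * fact k)"
  using integral_normal_moment_even[OF assms, of 0 k] by (simp add: gauss_moment_altdef[OF assms])

lemma gauss_moment_odd:
  assumes "\<sigma> > 0"
  shows "gauss_moment \<sigma> (2 * k + 1) = 0"
  using integral_normal_moment_odd[OF assms, of 0 k] by (simp add: gauss_moment_altdef[OF assms])

lemma gauss_moment_nonneg:
  assumes "\<sigma> > 0"
  shows "0 \<le> gauss_moment \<sigma> k"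
proof (cases "even k")
  case True
  then show ?thesis by (auto elim!: evenE simp: gauss_moment_even[OF assms])
next
  case False
  then show ?thesis using gauss_moment_odd[OF assms] by (auto elim!: oddE)
qed

text \<open>This is Gaussian integration by parts for monomials, read off here from the closed
  formulas for the moments. It is the source of every growth factor below.\<close>

lemma gauss_moment_add_2:
  assumes "\<sigma> > 0"
  shows "gauss_moment \<sigma> (k + 2) = \<sigma>\<^sup>2 * (real k + 1) * gauss_moment \<sigma> k"
proof (cases "even k")
  case True
  then obtain m where m: "k = 2 * m" by (elim evenE)
  have "gauss_moment \<sigma> (2 * m + 2) = gauss_moment \<sigma> (2 * Suc m)" by simp
  also have "\<dots> = \<sigma>\<^sup>2 * (real (2 * m) + 1) * gauss_moment \<sigma> (2 * m)"
  proof -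
    define p f F :: real where "p = (2 / \<sigma>\<^sup>2) ^ m" and "f = fact m" and "F = fact (2 * m)"
    have nz: "p \<noteq> 0" "f \<noteq> 0" using assms by (auto simp: p_def f_def)
    have "fact (2 * Suc m) = (2 * (real m + 1)) * (2 * real m + 1) * F"
      by (simp add: F_def algebra_simps)
    moreover have "(2 / \<sigma>\<^sup>2) ^ Suc m * fact (Suc m) = 2 * (real m + 1) * (p * f / \<sigma>\<^sup>2)"
      by (simp add: p_def f_def algebra_simps)
    moreover have "(2 * (real m + 1)) * (2 * real m + 1) * F / (2 * (real m + 1) * (p * f / \<sigma>\<^sup>2))
        = \<sigma>\<^sup>2 * (2 * real m + 1) * (F / (p * f))"
      using nz assms
        mult_divide_mult_cancel_left[of "2 * (real m + 1)" "(2 * real m + 1) * F" "p * f / \<sigma>\<^sup>2"]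
      by (simp add: mult.assoc)
    moreover have "gauss_moment \<sigma> (2 * m) = F / (p * f)"
      unfolding gauss_moment_even[OF assms] p_def f_def F_def ..
    ultimately show ?thesis
      unfolding gauss_moment_even[OF assms, of "Suc m"] by (simp only: of_nat_mult of_nat_numeral)
  qed
  finally show ?thesis unfolding m .
next
  case False
  then obtain m where m: "k = 2 * m + 1" by (elim oddE)
  show ?thesis using gauss_moment_odd[OF assms, of m] gauss_moment_odd[OF assms, of "m + 1"]
    by (simp add: m)
qed

text \<open>Collecting equal variables into powers puts a monomial in the form that factorises under
  a product measure.\<close>

lemma prod_list_map_eq_prod_count:
  fixes f :: "'a \<Rightarrow> 'b :: comm_monoid_mult"
  assumes "set xs \<subseteq> X" "finite X"
  shows "prod_list (map f xs) = (\<Prod>x\<in>X. f x ^ count_list xs x)"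
  using assms
proof (induction xs)
  case (Cons a xs)
  have "(\<Prod>x\<in>X. f x ^ count_list (a # xs) x) = (\<Prod>x\<in>X. (if x = a then f a else 1) * f x ^ count_list xs x)"
    by (intro prod.cong) auto
  also have "\<dots> = f a * (\<Prod>x\<in>X. f x ^ count_list xs x)"
    using Cons.prems by (simp add: prod.distrib)
  finally show ?case using Cons by simp
qed simp

text \<open>Homogeneous polynomial functions of degree \<open>d\<close> with natural coefficients, a monomial being
  represented by the list of its variables.\<close>
inductive nnpoly :: "'a set \<Rightarrow> nat \<Rightarrow> (('a \<Rightarrow> real) \<Rightarrow> real) \<Rightarrow> bool" for X where
  zero: "nnpoly X d (\<lambda>_. 0)"
| mono: "set xs \<subseteq> X \<Longrightarrow> length xs = d \<Longrightarrow> nnpoly X d (\<lambda>W. prod_list (map W xs))"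
| add: "nnpoly X d f \<Longrightarrow> nnpoly X d g \<Longrightarrow> nnpoly X d (\<lambda>W. f W + g W)"

lemma nnpoly_sum:
  assumes "\<And>i. i \<in> I \<Longrightarrow> nnpoly X d (f i)"
  shows "nnpoly X d (\<lambda>W. \<Sum>i\<in>I. f i W)"
proof (cases "finite I")
  case True
  then show ?thesis using assms by (induction I) (auto intro: nnpoly.intros)
qed (auto intro: nnpoly.zero)

lemma nnpoly_mult_mono:
  assumes "nnpoly X d f" "set xs \<subseteq> X"
  shows "nnpoly X (length xs + d) (\<lambda>W. prod_list (map W xs) * f W)"
  using assms
proof induction
  case (mono ys d)
  then show ?case using nnpoly.mono[of "xs @ ys" X "length xs + d"] by simp
qed (auto simp: distrib_left intro: nnpoly.intros)

lemma nnpoly_mult: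
  assumes "nnpoly X d f" "nnpoly X e g"
  shows "nnpoly X (d + e) (\<lambda>W. f W * g W)"
  using assms
proof induction
  case (mono xs d)
  then show ?case using nnpoly_mult_mono by blast
qed (auto simp: distrib_right intro: nnpoly.intros)

lemma nnpoly_one: "nnpoly X 0 (\<lambda>_. 1)"
  using nnpoly.mono[of "[]" X 0] by simp

lemma nnpoly_var: "x \<in> X \<Longrightarrow> nnpoly X 1 (\<lambda>W. W x)"
  using nnpoly.mono[of "[x]" X 1] by simp

lemma nnpoly_square_mult:
  assumes "nnpoly X d f" "e \<in> X"
  shows "nnpoly X (2 + d) (\<lambda>W. (W e)\<^sup>2 * f W)"
  using nnpoly_mult_mono[OF assms(1), of "[e, e]"] assms(2)
  by (simp add: power2_eq_square mult.assoc)

section \<open>Path recursion for \<open>beta\<close>\<close>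

lemma beta_0: "beta N W i 0 = 1"
  by (simp add: beta_def)

text \<open>A path of length \<open>Suc l\<close> is its first edge followed by a path of length
  \<open>l\<close> from the vertex reached.\<close>

lemma beta_Suc: "beta N W i (Suc l) = (\<Sum>j<N. W (i, j) * beta N W j l)"
proof -
  let ?P = "\<lambda>l. Pi\<^sub>E {..<l} (\<lambda>_. {..<N})"
  let ?w = "\<lambda>i p l. \<Prod>k<l. W (if k = 0 then i else p (k - 1), p k)"
  have "(\<Sum>j<N. W (i, j) * beta N W j l) = (\<Sum>(j, p)\<in>{..<N} \<times> ?P l. W (i, j) * ?w j p l)"
    unfolding beta_def sum_distrib_left by (simp add: sum.cartesian_product)
  also have "\<dots> = (\<Sum>q\<in>?P (Suc l). ?w i q (Suc l))"
  \<comment> \<open>The two maps remove and prepend the first vertex; the value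
    \<open>undefined\<close> off the index range keeps the results inside the extensional function
    spaces.\<close>
  proof (rule sum.reindex_bij_witness[where
        i = "\<lambda>q. (q 0, \<lambda>k. if k < l then q (Suc k) else undefined)" and
        j = "\<lambda>(j, p) k. case k of 0 \<Rightarrow> j | Suc m \<Rightarrow> if m < l then p m else undefined"], goal_cases)
    case (1 a)
    obtain j p where a: "a = (j, p)" by (cases a)
    have "p k = undefined" if "\<not> k < l" for k
      using 1 that unfolding a by (auto intro: PiE_arb)
    then show ?case unfolding a by (simp add: fun_eq_iff)
  next
    case (2 a)
    obtain j p where a: "a = (j, p)" by (cases a)
    have "j < N" "\<And>k. k < l \<Longrightarrow> p k < N" using 2 unfolding a by auto
    then show ?case unfolding a by (intro PiE_I) (simp_all split: nat.splits)
  next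
    case (3 q)
    have "q k = undefined" if "\<not> k < Suc l" for k
      using 3 that by (auto intro: PiE_arb)
    then show ?case by (simp add: fun_eq_iff split: nat.splits)
  next
    case (4 q)
    have "q k < N" if "k < Suc l" for k using 4 that by auto
    then show ?case by (auto intro!: PiE_I split: if_splits)
  next
    case (5 a)
    obtain j p where a: "a = (j, p)" by (cases a)
    show ?case unfolding a prod.lessThan_Suc_shift
      by (auto intro!: prod.cong arg_cong[of _ _ W] split: nat.splits)
  qed
  finally show ?thesis by (simp add: beta_def)
qed

lemma nnpoly_beta:
  assumes "i < N"
  shows "nnpoly ({..<N} \<times> {..<N}) l (\<lambda>W. beta N W i l)"
  using assms
proof (induction l arbitrary: i)
  case 0
  then show ?case by (simp add: beta_0 nnpoly_one)
next
  case (Suc l)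
  show ?case unfolding beta_Suc
    using Suc nnpoly_mult[OF nnpoly_var Suc.IH, of "(i, _)"] by (intro nnpoly_sum) auto
qed

lemma nnpoly_beta_square:
  "i < N \<Longrightarrow> nnpoly ({..<N} \<times> {..<N}) (2 * l) (\<lambda>W. (beta N W i l)\<^sup>2)"
  using nnpoly_mult[OF nnpoly_beta nnpoly_beta, of i N i l l] by (simp add: power2_eq_square mult_2)

text \<open>Squaring the recursion for beta, the cross terms form again a polynomial with nonnegative
  coefficients, so they may be dropped under the expectation.\<close>
lemma beta_Suc_square:
  assumes "i < N"
  obtains r where "nnpoly ({..<N} \<times> {..<N}) (2 * l + 2) r"
    "\<And>W. (beta N W i (Suc l))\<^sup>2 = (\<Sum>j<N. (W (i, j))\<^sup>2 * (beta N W j l)\<^sup>2) + r W"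
proof
  \<comment> \<open>The pairs of paths whose first edges differ.\<close>
  let ?r = "\<lambda>W. \<Sum>j<N. \<Sum>k\<in>{..<N} - {j}. (W (i, j) * beta N W j l) * (W (i, k) * beta N W k l)"
  have t: "nnpoly ({..<N} \<times> {..<N}) (1 + l) (\<lambda>W. W (i, j) * beta N W j l)" if "j < N" for j
    by (rule nnpoly_mult[OF nnpoly_var nnpoly_beta]) (use that assms in auto)
  have "nnpoly ({..<N} \<times> {..<N}) ((1 + l) + (1 + l)) ?r"
    by (intro nnpoly_sum nnpoly_mult t) auto
  also have "(1 + l) + (1 + l) = 2 * l + 2" by simp
  finally show "nnpoly ({..<N} \<times> {..<N}) (2 * l + 2) ?r" .
  fix W
  have "(beta N W i (Suc l))\<^sup>2 = (\<Sum>j<N. \<Sum>k<N. (W (i, j) * beta N W j l) * (W (i, k) * beta N W k l))"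
    unfolding beta_Suc power2_eq_square by (rule sum_product)
  also have "\<dots> = (\<Sum>j<N. (W (i, j))\<^sup>2 * (beta N W j l)\<^sup>2
      + (\<Sum>k\<in>{..<N} - {j}. (W (i, j) * beta N W j l) * (W (i, k) * beta N W k l)))"
    by (intro sum.cong refl, subst sum.remove) (auto simp: power2_eq_square mult_ac)
  finally show "(beta N W i (Suc l))\<^sup>2 = (\<Sum>j<N. (W (i, j))\<^sup>2 * (beta N W j l)\<^sup>2) + ?r W"
    by (simp add: sum.distrib)
qed

text \<open>The diagonal entries do not depend on the order \<open>T\<close>, so they form a single
  sequence in \<open>l\<close> whose growth can be studied without the matrix.\<close>

definition diag_moment :: "nat \<Rightarrow> real \<Rightarrow> nat \<Rightarrow> real" where
  "diag_moment N \<sigma> l = (\<Sum>i<N. \<integral>W. (beta N W i l)\<^sup>2 \<partial>gauss_matrix_measure N \<sigma>)"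

lemma moment_matrix_sym:
  "i \<le> T \<Longrightarrow> j \<le> T \<Longrightarrow> moment_matrix N \<sigma> T $$ (i, j) = moment_matrix N \<sigma> T $$ (j, i)"
  by (simp add: moment_matrix_def mult.commute)

section \<open>Expectations over the Gaussian matrix\<close>

context
  fixes N :: nat and \<sigma> :: real
  assumes \<sigma>: "\<sigma> > 0"
begin

private abbreviation "E \<equiv> {..<N} \<times> {..<N}"
private abbreviation "G \<equiv> gauss_matrix_measure N \<sigma>"

lemma gauss_monomial:
  assumes "set xs \<subseteq> E"
  shows "integrable G (\<lambda>W. prod_list (map W xs))"
    and "(\<integral>W. prod_list (map W xs) \<partial>G) = (\<Prod>e\<in>E. gauss_moment \<sigma> (count_list xs e))"
proof -
  interpret g: prob_space "density lborel (normal_density 0 \<sigma>)"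
    by (rule prob_space_normal_density[OF \<sigma>])
  interpret product_sigma_finite "\<lambda>_::nat \<times> nat. density lborel (normal_density 0 \<sigma>)"
    by standard
  have eq: "prod_list (map W xs) = (\<Prod>e\<in>E. W e ^ count_list xs e)" for W :: "nat \<times> nat \<Rightarrow> real"
    by (rule prod_list_map_eq_prod_count[OF assms]) simp
  show "integrable G (\<lambda>W. prod_list (map W xs))"
    unfolding eq gauss_matrix_measure_def
    by (rule product_integrable_prod) (auto intro: integrable_gauss_power[OF \<sigma>])
  show "(\<integral>W. prod_list (map W xs) \<partial>G) = (\<Prod>e\<in>E. gauss_moment \<sigma> (count_list xs e))"
    unfolding eq gauss_matrix_measure_def gauss_moment_def
    by (rule product_integral_prod) (auto intro: integrable_gauss_power[OF \<sigma>])
qed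

text \<open>Multiplication by \<open>(W e)\<^sup>2\<close> raises only the exponent of
  \<open>e\<close>, by two, so just one factor of the product of moments changes.\<close>

lemma gauss_monomial_square:
  assumes xs: "set xs \<subseteq> E" and e: "e \<in> E"
  shows "(\<integral>W. (W e)\<^sup>2 * prod_list (map W xs) \<partial>G) =
    \<sigma>\<^sup>2 * (real (count_list xs e) + 1) * (\<integral>W. prod_list (map W xs) \<partial>G)"
proof -
  have "(\<integral>W. (W e)\<^sup>2 * prod_list (map W xs) \<partial>G) = (\<integral>W. prod_list (map W (e # e # xs)) \<partial>G)"
    by (simp add: power2_eq_square mult.assoc)
  also have "\<dots> = (\<Prod>e'\<in>E. gauss_moment \<sigma> (count_list (e # e # xs) e'))"
    by (rule gauss_monomial(2)) (use xs e in auto)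
  also have "\<dots> = (\<Prod>e'\<in>E. (if e' = e then \<sigma>\<^sup>2 * (real (count_list xs e) + 1) else 1)
      * gauss_moment \<sigma> (count_list xs e'))"
    using gauss_moment_add_2[OF \<sigma>] by (intro prod.cong) auto
  also have "\<dots> = \<sigma>\<^sup>2 * (real (count_list xs e) + 1) * (\<Prod>e'\<in>E. gauss_moment \<sigma> (count_list xs e'))"
    using e by (simp add: prod.distrib)
  finally show ?thesis by (simp add: gauss_monomial(2)[OF xs])
qed

lemma integrable_nnpoly: "nnpoly E d f \<Longrightarrow> integrable G f"
  by (induction rule: nnpoly.induct) (auto intro: gauss_monomial(1))

lemma integral_nnpoly_nonneg: "nnpoly E d f \<Longrightarrow> 0 \<le> (\<integral>W. f W \<partial>G)"
proof (induction rule: nnpoly.induct)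
  case (mono xs d)
  then show ?case
    by (simp add: gauss_monomial(2) prod_nonneg gauss_moment_nonneg[OF \<sigma>])
qed (auto simp: integrable_nnpoly)

text \<open>For a monomial the exact factor is \<open>\<sigma>\<^sup>2\<close> times one plus the
  exponent of \<open>e\<close>; nonnegative expectations allow the exponent to be dropped.\<close>

lemma integral_square_mult_ge:
  assumes "nnpoly E d f" "e \<in> E"
  shows "\<sigma>\<^sup>2 * (\<integral>W. f W \<partial>G) \<le> (\<integral>W. (W e)\<^sup>2 * f W \<partial>G)"
  using assms
proof (induction rule: nnpoly.induct)
  case (mono xs d)
  have "0 \<le> (\<integral>W. prod_list (map W xs) \<partial>G)"
    by (rule integral_nnpoly_nonneg[OF nnpoly.mono]) (use mono in auto)
  then show ?case using gauss_monomial_square[of xs e] mono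
    by (auto simp: mult_right_mono distrib_left distrib_right)
next
  case (add d f g)
  then show ?case
    by (simp add: distrib_left integrable_nnpoly nnpoly_square_mult[THEN integrable_nnpoly])
qed simp

text \<open>Euler's identity for homogeneous functions, in Gaussian form.\<close>
lemma sum_integral_square_mult:
  assumes "nnpoly E d f"
  shows "(\<Sum>e\<in>E. \<integral>W. (W e)\<^sup>2 * f W \<partial>G) = \<sigma>\<^sup>2 * ((real N)\<^sup>2 + real d) * (\<integral>W. f W \<partial>G)"
  using assms
proof (induction rule: nnpoly.induct)
  case (mono xs d)
  have "(\<Sum>e\<in>E. count_list xs e) = d"
    using mono sum_count_set[of xs E] by simp
  then have c: "(\<Sum>e\<in>E. real (count_list xs e)) = real d"
    by (simp flip: of_nat_sum)
  have "(\<Sum>e\<in>E. \<integral>W. (W e)\<^sup>2 * prod_list (map W xs) \<partial>G)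
      = (\<Sum>e\<in>E. \<sigma>\<^sup>2 * (real (count_list xs e) + 1) * (\<integral>W. prod_list (map W xs) \<partial>G))"
    by (intro sum.cong refl gauss_monomial_square mono)
  also have "\<dots> = \<sigma>\<^sup>2 * (\<Sum>e\<in>E. real (count_list xs e) + 1) * (\<integral>W. prod_list (map W xs) \<partial>G)"
    by (simp only: sum_distrib_left sum_distrib_right)
  also have "(\<Sum>e\<in>E. real (count_list xs e) + 1) = (real N)\<^sup>2 + real d"
    unfolding sum.distrib c by (simp add: power2_eq_square)
  finally show ?case .
next
  case (add d f g)
  have "(\<Sum>e\<in>E. \<integral>W. (W e)\<^sup>2 * (f W + g W) \<partial>G)
      = (\<Sum>e\<in>E. (\<integral>W. (W e)\<^sup>2 * f W \<partial>G) + (\<integral>W. (W e)\<^sup>2 * g W \<partial>G))"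
    using add.hyps
    by (intro sum.cong refl) (simp add: distrib_left nnpoly_square_mult[THEN integrable_nnpoly])
  then show ?case using add by (simp add: sum.distrib distrib_left integrable_nnpoly)
qed simp

section \<open>Growth of the diagonal and semidefiniteness\<close>

lemma moment_matrix_diag:
  "l \<le> T \<Longrightarrow> moment_matrix N \<sigma> T $$ (l, l) = diag_moment N \<sigma> l"
  unfolding moment_matrix_def diag_moment_def
  by (auto simp: power2_eq_square[symmetric] intro!: Bochner_Integration.integral_sum
      integrable_nnpoly[OF nnpoly_beta_square])

lemma prob_space_gauss: "prob_space G"
  unfolding gauss_matrix_measure_def
  by (intro prob_space_PiM prob_space_normal_density \<sigma>)

lemma diag_moment_0: "diag_moment N \<sigma> 0 = real N"
proof -
  interpret prob_space G by (rule prob_space_gauss)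
  show ?thesis by (simp add: diag_moment_def beta_0 prob_space)
qed

text \<open>The weight \<open>f\<close> stands for edges already prepended, so that the step can be
  used twice in a row; \<open>f = 1\<close> gives the unweighted version.\<close>

lemma integral_beta_Suc_square_ge:
  assumes i: "i < N" and f: "nnpoly E d f"
  shows "(\<Sum>j<N. \<integral>W. (W (i, j))\<^sup>2 * (f W * (beta N W j l)\<^sup>2) \<partial>G)
    \<le> (\<integral>W. f W * (beta N W i (Suc l))\<^sup>2 \<partial>G)"
proof -
  obtain r where r: "nnpoly E (2 * l + 2) r"
    and eq: "\<And>W. (beta N W i (Suc l))\<^sup>2 = (\<Sum>j<N. (W (i, j))\<^sup>2 * (beta N W j l)\<^sup>2) + r W"
    using beta_Suc_square[OF i] by blast
  have int: "integrable G (\<lambda>W. (W (i, j))\<^sup>2 * (f W * (beta N W j l)\<^sup>2))" if "j < N" for j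
    by (rule integrable_nnpoly[OF nnpoly_square_mult[OF nnpoly_mult[OF f nnpoly_beta_square]]])
      (use that i in auto)
  have "(\<integral>W. f W * (beta N W i (Suc l))\<^sup>2 \<partial>G)
      = (\<integral>W. (\<Sum>j<N. (W (i, j))\<^sup>2 * (f W * (beta N W j l)\<^sup>2)) + f W * r W \<partial>G)"
    unfolding eq by (simp add: distrib_left sum_distrib_left mult_ac)
  also have "\<dots> = (\<Sum>j<N. \<integral>W. (W (i, j))\<^sup>2 * (f W * (beta N W j l)\<^sup>2) \<partial>G) + (\<integral>W. f W * r W \<partial>G)"
    using int integrable_nnpoly[OF nnpoly_mult[OF f r]]
    by (subst Bochner_Integration.integral_add) (auto intro!: Bochner_Integration.integral_sum)
  finally show ?thesis using integral_nnpoly_nonneg[OF nnpoly_mult[OF f r]] by simp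
qed

text \<open>Each path from \<open>j\<close> can be preceded by an edge from any of \<open>N\<close>
  vertices, and each shared edge contributes at least \<open>\<sigma>\<^sup>2\<close>.\<close>

lemma diag_moment_Suc_ge: "\<sigma>\<^sup>2 * real N * diag_moment N \<sigma> l \<le> diag_moment N \<sigma> (Suc l)"
proof -
  have "\<sigma>\<^sup>2 * real N * diag_moment N \<sigma> l = (\<Sum>i<N. \<Sum>j<N. \<sigma>\<^sup>2 * (\<integral>W. (beta N W j l)\<^sup>2 \<partial>G))"
    by (simp add: diag_moment_def sum_distrib_left mult_ac)
  also have "\<dots> \<le> (\<Sum>i<N. \<Sum>j<N. \<integral>W. (W (i, j))\<^sup>2 * (beta N W j l)\<^sup>2 \<partial>G)"
    by (intro sum_mono integral_square_mult_ge[OF nnpoly_beta_square]) auto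
  also have "\<dots> \<le> diag_moment N \<sigma> (Suc l)"
    unfolding diag_moment_def
    using integral_beta_Suc_square_ge[OF _ nnpoly_one] by (intro sum_mono) simp
  finally show ?thesis .
qed

text \<open>Prepend the same two edges to both paths: the second edge contributes a factor at least
  \<open>\<sigma>\<^sup>2\<close>, and summing over the first one gives the factor growing with \<open>l\<close> by Euler's identity.\<close>
lemma diag_moment_add_2_ge:
  "\<sigma> ^ 4 * ((real N)\<^sup>2 + 2 * real l) * diag_moment N \<sigma> l \<le> diag_moment N \<sigma> (l + 2)"
proof -
  let ?b = "\<lambda>j l W. (beta N W j l)\<^sup>2"
  have "\<sigma> ^ 4 * ((real N)\<^sup>2 + 2 * real l) * diag_moment N \<sigma> l
      = (\<Sum>j<N. \<sigma>\<^sup>2 * (\<sigma>\<^sup>2 * ((real N)\<^sup>2 + real (2 * l)) * (\<integral>W. ?b j l W \<partial>G)))"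
    by (simp add: diag_moment_def sum_distrib_left mult_ac power4_eq_xxxx power2_eq_square)
  also have "\<dots> = (\<Sum>j<N. \<sigma>\<^sup>2 * (\<Sum>e\<in>E. \<integral>W. (W e)\<^sup>2 * ?b j l W \<partial>G))"
    by (intro sum.cong refl) (simp only: sum_integral_square_mult[OF nnpoly_beta_square] lessThan_iff)
  also have "\<dots> = (\<Sum>j<N. \<Sum>a<N. \<Sum>c<N. \<sigma>\<^sup>2 * (\<integral>W. (W (a, c))\<^sup>2 * ?b j l W \<partial>G))"
    by (simp add: sum_distrib_left sum.cartesian_product)
  \<comment> \<open>The free edge \<open>(a, c)\<close> is linked to the path from \<open>j\<close>
    by inserting the edge \<open>(c, j)\<close>.\<close>
  also have "\<dots> \<le> (\<Sum>j<N. \<Sum>a<N. \<Sum>c<N. \<integral>W. (W (c, j))\<^sup>2 * ((W (a, c))\<^sup>2 * ?b j l W) \<partial>G)"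
    by (intro sum_mono integral_square_mult_ge[OF nnpoly_square_mult[OF nnpoly_beta_square]]) auto
  also have "\<dots> = (\<Sum>a<N. \<Sum>j<N. \<Sum>c<N. \<integral>W. (W (c, j))\<^sup>2 * ((W (a, c))\<^sup>2 * ?b j l W) \<partial>G)"
    by (rule sum.swap)
  also have "\<dots> = (\<Sum>a<N. \<Sum>c<N. \<Sum>j<N. \<integral>W. (W (c, j))\<^sup>2 * ((W (a, c))\<^sup>2 * ?b j l W) \<partial>G)"
    by (rule sum.cong[OF refl]) (rule sum.swap)
  \<comment> \<open>The sum over \<open>j\<close> is absorbed with weight
    \<open>(W (a, c))\<^sup>2\<close>; the sum over \<open>c\<close> then follows with weight
    1.\<close>
  also have "\<dots> \<le> (\<Sum>a<N. \<Sum>c<N. \<integral>W. (W (a, c))\<^sup>2 * ?b c (Suc l) W \<partial>G)"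
  proof (intro sum_mono integral_beta_Suc_square_ge)
    fix a c assume "a \<in> {..<N}" "c \<in> {..<N}"
    then show "nnpoly E 2 (\<lambda>W. (W (a, c))\<^sup>2)"
      using nnpoly_square_mult[OF nnpoly_one, of "(a, c)"] by simp
  qed auto
  also have "\<dots> \<le> diag_moment N \<sigma> (Suc (Suc l))"
    unfolding diag_moment_def
    using integral_beta_Suc_square_ge[OF _ nnpoly_one] by (intro sum_mono) simp
  finally show ?thesis by simp
qed

text \<open>The matrix is an expected Gram matrix: its quadratic form is the expectation of a sum of
  squares, one for each vertex \<open>m\<close>.\<close>

lemma moment_matrix_psd:
  "0 \<le> (\<Sum>i<T + 1. \<Sum>j<T + 1. moment_matrix N \<sigma> T $$ (i, j) * v i * v j)"
proof -
  let ?B = "\<lambda>i j W. \<Sum>m<N. beta N W m i * beta N W m j"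
  have int: "integrable G (?B i j)" for i j
    by (rule integrable_nnpoly[OF nnpoly_sum[OF nnpoly_mult[OF nnpoly_beta nnpoly_beta]]]) auto
  have "(\<Sum>i<T + 1. \<Sum>j<T + 1. moment_matrix N \<sigma> T $$ (i, j) * v i * v j)
      = (\<Sum>i<T + 1. \<Sum>j<T + 1. \<integral>W. ?B i j W * (v i * v j) \<partial>G)"
    by (intro sum.cong refl) (use int in \<open>simp add: moment_matrix_def mult.assoc\<close>)
  also have "\<dots> = (\<integral>W. (\<Sum>i<T + 1. \<Sum>j<T + 1. ?B i j W * (v i * v j)) \<partial>G)"
    using int
    by (simp only: Bochner_Integration.integral_sum integrable_mult_left
        Bochner_Integration.integrable_sum)
  also have "\<dots> = (\<integral>W. (\<Sum>m<N. (\<Sum>i<T + 1. v i * beta N W m i)\<^sup>2) \<partial>G)"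
  proof (rule Bochner_Integration.integral_cong[OF refl])
    fix W
    have "(\<Sum>i<T + 1. \<Sum>j<T + 1. ?B i j W * (v i * v j))
        = (\<Sum>i<T + 1. \<Sum>j<T + 1. \<Sum>m<N. (v i * beta N W m i) * (v j * beta N W m j))"
      by (simp only: sum_distrib_right) (simp only: mult_ac)
    also have "\<dots> = (\<Sum>i<T + 1. \<Sum>m<N. \<Sum>j<T + 1. (v i * beta N W m i) * (v j * beta N W m j))"
      by (rule sum.cong[OF refl]) (rule sum.swap)
    also have "\<dots> = (\<Sum>m<N. \<Sum>i<T + 1. \<Sum>j<T + 1. (v i * beta N W m i) * (v j * beta N W m j))"
      by (rule sum.swap)
    also have "\<dots> = (\<Sum>m<N. (\<Sum>i<T + 1. v i * beta N W m i)\<^sup>2)"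
      unfolding power2_eq_square sum_product ..
    finally show "(\<Sum>i<T + 1. \<Sum>j<T + 1. ?B i j W * (v i * v j))
        = (\<Sum>m<N. (\<Sum>i<T + 1. v i * beta N W m i)\<^sup>2)" .
  qed
  also have "0 \<le> \<dots>" by (intro Bochner_Integration.integral_nonneg sum_nonneg) simp
  finally show ?thesis .
qed

end

section \<open>Summation of growing sequences\<close>

text \<open>The top two terms and the next two are bounded sharply, giving the factors 1 and
  \<open>1 / (2 * s * (real T - 3))\<close>. The remaining tail needs only a crude bound with a
  constant independent of \<open>T\<close>, which the numerator \<open>real T\<close> of the last
  term absorbs for large \<open>T\<close>.\<close>

lemma sum_le_two_step_growth:
  fixes b :: "nat \<Rightarrow> real" and c s :: real
  assumes pos: "\<And>l. b l > 0" and c: "c > 0" and s: "s > 0"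
    and step: "\<And>l. c * b l \<le> b (Suc l)"
    and two_step: "\<And>l. 2 * s * real l * b l \<le> b (l + 2)"
  shows "\<exists>T0\<ge>6. \<forall>T\<ge>T0. (\<Sum>l\<le>T. b l) \<le>
    min 2 (1 + 1 / c) * (1 + 1 / (2 * s * (real T - 3)) + real T / (8 * s\<^sup>2 * (real T - 5)\<^sup>2))
      * max (b T) (b (T - 1))"
proof -
  define M where "M = min 2 (1 + 1 / c)"
  define m where "m T = max (b T) (b (T - 1))" for T
  define S where "S T = (\<Sum>l\<le>T. b l)" for T
  have M: "1 \<le> M" using c by (auto simp: M_def)
  have m_pos: "0 < m T" for T using pos[of T] by (simp add: m_def less_max_iff_disj)
  have pair: "b T + b (T - 1) \<le> M * m T" if "T \<ge> 1" for T
  proof -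
    have "b (T - 1) \<le> b T / c"
      using step[of "T - 1"] that c by (simp add: field_simps)
    then have "b T + b (T - 1) \<le> (1 + 1 / c) * b T" by (simp add: algebra_simps)
    also have "\<dots> \<le> (1 + 1 / c) * m T"
      using c by (intro mult_left_mono) (auto simp: m_def)
    finally have "b T + b (T - 1) \<le> (1 + 1 / c) * m T" .
    moreover have "b T + b (T - 1) \<le> 2 * m T" by (simp add: m_def)
    ultimately show ?thesis by (simp add: M_def min_def)
  qed
  \<comment> \<open>The maximum \<open>m (T - 2)\<close> involves the indices \<open>T - 2\<close>
    and \<open>T - 3\<close>; the smaller one dictates the common factor.\<close>
  have growth: "2 * s * (real T - 3) * m (T - 2) \<le> m T" if "T \<ge> 3" for T
  proof -
    have "2 * s * (real T - 3) * b (T - 2) \<le> 2 * s * real (T - 2) * b (T - 2)"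
      using that s pos[of "T - 2"] by (intro mult_right_mono) (auto simp: of_nat_diff)
    also have "\<dots> \<le> b T" using two_step[of "T - 2"] le_add_diff_inverse2[of 2 T] that by simp
    finally have 1: "2 * s * (real T - 3) * b (T - 2) \<le> m T" by (simp add: m_def)
    have "T - 3 + 2 = T - 1" using that by simp
    then have "2 * s * (real T - 3) * b (T - 3) \<le> b (T - 1)"
      using two_step[of "T - 3"] that by (simp add: of_nat_diff)
    then have 2: "2 * s * (real T - 3) * b (T - 3) \<le> m T" by (simp add: m_def)
    have "T - 2 - 1 = T - 3" by simp
    then show ?thesis using 1 2 unfolding m_def[of "T - 2"] by (auto simp: max_def)
  qed
  have S_split: "S T = b T + b (T - 1) + S (T - 2)" if "T \<ge> 2" for T
  proof -
    define k where "k = T - 2"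
    have "T = Suc (Suc k)" using that by (simp add: k_def)
    then show ?thesis by (simp add: S_def)
  qed
  \<comment> \<open>From \<open>T1\<close> on, the growth factor of \<open>m\<close> over two steps
    is at least 2.\<close>
  obtain T1 :: nat where T1: "1 / s + 3 < real T1" using reals_Archimedean2 by blast
  have T1_ge: "T1 \<ge> 3" 
  proof -
    have "0 < 1 / s" using s by simp
    then have "3 < real T1" using T1 by linarith
    then show ?thesis by simp
  qed
  \<comment> \<open>The sum covers all \<open>T < T1\<close>; the summand 4 closes the induction,
    since \<open>2 + K / 2 \<le> K\<close> requires \<open>K \<ge> 4\<close>.\<close>
  define K where "K = 4 + (\<Sum>T<T1. S T / m T)"
  have S_pos: "0 < S T" for T unfolding S_def by (intro sum_pos pos) auto
  have K: "4 \<le> K" unfolding K_def using S_pos m_pos by (simp add: sum_nonneg less_imp_le)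
  have S_le: "S T \<le> K * m T" for T
  proof (induction T rule: less_induct)
    case (less T)
    show ?case
    proof (cases "T < T1")
      case True
      have "S T / m T \<le> (\<Sum>T<T1. S T / m T)"
        using True S_pos m_pos by (intro member_le_sum) (auto simp: less_imp_le)
      then have "S T / m T \<le> K" by (simp add: K_def)
      then show ?thesis using m_pos[of T] by (simp add: divide_le_eq)
    next
      case False
      then have T: "T \<ge> 3" "real T1 \<le> real T" using T1_ge by auto
      have "1 / s \<le> real T - 3" using T1 T by linarith
      then have "1 \<le> s * (real T - 3)" using s by (simp add: divide_le_eq mult.commute)
      then have "2 * m (T - 2) \<le> 2 * s * (real T - 3) * m (T - 2)"
        using m_pos[of "T - 2"] by (intro mult_right_mono) auto
      then have "2 * m (T - 2) \<le> m T" using growth[OF T(1)] by simp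
      then have "K * m (T - 2) \<le> K * (m T / 2)" using K by (intro mult_left_mono) auto
      moreover have "S (T - 2) \<le> K * m (T - 2)" using less.IH T by simp
      moreover have "b T + b (T - 1) \<le> 2 * m T" by (simp add: m_def)
      moreover have "4 * m T \<le> K * m T" using K m_pos[of T] by simp
      ultimately show ?thesis using S_split[of T] T by simp
    qed
  qed
  \<comment> \<open>Beyond \<open>T2\<close> the constant \<open>K\<close> is at most
    \<open>real T / 2\<close>.\<close>
  obtain T2 :: nat where T2: "2 * K \<le> real T2" using real_arch_simple by blast
  show ?thesis
  proof (intro exI[of _ "max 6 T2"] conjI allI impI)
    fix T assume "max 6 T2 \<le> T"
    then have T: "T \<ge> 6" "2 * K \<le> real T" using T2 by auto
    define D1 where "D1 = 2 * s * (real T - 3)"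
    \<comment> \<open>The growth factor from \<open>T - 4\<close> to \<open>T - 2\<close>. As it is
      at most \<open>D1\<close>, two growth steps gain at least \<open>D2\<^sup>2\<close>.\<close>
    define D2 where "D2 = 2 * s * (real T - 5)"
    have D: "0 < D2" "D2 \<le> D1" "0 < D1" using T s by (auto simp: D1_def D2_def)
    have m2: "m (T - 2) \<le> m T / D1" using growth[of T] T D by (simp add: D1_def field_simps)
    have "T - 2 - 2 = T - 4" by simp
    then have "m (T - 4) \<le> m (T - 2) / D2"
      using growth[of "T - 2"] T D by (simp add: D2_def of_nat_diff field_simps)
    also have "\<dots> \<le> m T / D1 / D2" using m2 D by (intro divide_right_mono) auto
    also have "\<dots> \<le> m T / D2\<^sup>2"
      unfolding power2_eq_square divide_divide_eq_left
      using D m_pos[of T] by (intro divide_left_mono mult_right_mono) auto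
    finally have m4: "m (T - 4) \<le> m T / D2\<^sup>2" .
    have "S (T - 4) \<le> K * m (T - 4)" by (rule S_le)
    also have "\<dots> \<le> (real T / 2) * (m T / D2\<^sup>2)"
      using m4 T K m_pos[of "T - 4"] by (intro mult_mono) auto
    also have "\<dots> \<le> M * ((real T / 2) * (m T / D2\<^sup>2))"
      using mult_right_mono[OF M, of "(real T / 2) * (m T / D2\<^sup>2)"] m_pos[of T] by simp
    finally have S4: "S (T - 4) \<le> M * ((real T / 2) * (m T / D2\<^sup>2))" .
    have "T - 2 - 1 = T - 3" by simp
    then have "b (T - 2) + b (T - 3) \<le> M * m (T - 2)" using pair[of "T - 2"] T by simp
    also have "\<dots> \<le> M * (m T / D1)" using m2 M by (intro mult_left_mono) auto
    finally have p2: "b (T - 2) + b (T - 3) \<le> M * (m T / D1)" .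
    have "S T = (b T + b (T - 1)) + (b (T - 2) + b (T - 3)) + S (T - 4)"
      using S_split[of T] S_split[of "T - 2"] T by (simp add: numeral_eq_Suc)
    also have "\<dots> \<le> M * m T + M * (m T / D1) + M * ((real T / 2) * (m T / D2\<^sup>2))"
      by (intro add_mono pair p2 S4) (use T in simp)
    also have "\<dots> = M * (1 + 1 / D1 + real T / (2 * D2\<^sup>2)) * m T"
      by (simp add: algebra_simps)
    also have "2 * D2\<^sup>2 = 8 * s\<^sup>2 * (real T - 5)\<^sup>2"
      by (simp add: D2_def power_mult_distrib)
    finally show "(\<Sum>l\<le>T. b l) \<le> min 2 (1 + 1 / c) *
        (1 + 1 / (2 * s * (real T - 3)) + real T / (8 * s\<^sup>2 * (real T - 5)\<^sup>2)) * max (b T) (b (T - 1))"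
      unfolding S_def M_def m_def D1_def .
  qed simp
qed

text \<open>Iterating the one-step growth \<open>k\<close> times bounds \<open>b (T - k)\<close> by
  \<open>b T\<close> divided by \<open>c ^ k\<close>.\<close>

lemma sum_le_geometric_growth:
  fixes b :: "nat \<Rightarrow> real"
  assumes c: "c > 0" and step: "\<And>l. c * b l \<le> b (Suc l)"
  shows "(\<Sum>l\<le>T. b l) \<le> (\<Sum>l\<le>T. c powi (- int l)) * b T"
proof -
  have iter: "c ^ k * b l \<le> b (l + k)" for k l
  proof (induction k)
    case (Suc k)
    have "c ^ Suc k * b l \<le> c * b (l + k)" using Suc c by (simp add: mult.assoc)
    also have "\<dots> \<le> b (l + Suc k)" using step[of "l + k"] by simp
    finally show ?case .
  qed simp
  have "(\<Sum>l\<le>T. b l) = (\<Sum>k\<le>T. b (T - k))"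
    by (rule sum.nat_diff_reindex[symmetric, of b "Suc T",
          simplified lessThan_Suc_atMost, simplified])
  also have "\<dots> \<le> (\<Sum>k\<le>T. c powi (- int k) * b T)"
  proof (rule sum_mono)
    fix k assume "k \<in> {..T}"
    then show "b (T - k) \<le> c powi (- int k) * b T"
      using iter[of k "T - k"] c by (simp add: power_int_minus field_simps)
  qed
  finally show ?thesis by (simp add: sum_distrib_right)
qed

section \<open>Assembly of the eigenvalue bounds\<close>

theorem mainTheorem14:
  fixes N :: nat and \<sigma> :: real
  assumes "N \<ge> 1" and "\<sigma> > 0"
  shows "(\<forall>T \<ge> 1. \<forall>lams. sorted_eigenvalues (moment_matrix N \<sigma> T) lams \<longrightarrow>
            1 / P_bound \<sigma> N T \<le> lams ! 0 / sum_list lams \<and> lams ! 0 / sum_list lams \<le> 1)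
       \<and> (\<exists>T0 :: nat. T0 \<ge> 6 \<and>
            (\<forall>T \<ge> T0. \<forall>lams. sorted_eigenvalues (moment_matrix N \<sigma> T) lams \<longrightarrow>
               1 / Q_bound \<sigma> N T \<le> lams ! 0 / sum_list lams))"
proof -
  define b where "b = diag_moment N \<sigma>"
  define c where "c = \<sigma>\<^sup>2 * real N"
  have c: "c > 0" using assms by (simp add: c_def)
  have step: "c * b l \<le> b (Suc l)" for l
    unfolding b_def c_def by (rule diag_moment_Suc_ge[OF assms(2)])
  have pos: "b l > 0" for l
  proof (induction l)
    case 0
    then show ?case using assms by (simp add: b_def diag_moment_0)
  next
    case (Suc l)
    then show ?case using c step[of l] by (smt (verit) mult_pos_pos)
  qed
  have two_step: "2 * \<sigma> ^ 4 * real l * b l \<le> b (l + 2)" for l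
  proof -
    have "2 * \<sigma> ^ 4 * real l * b l \<le> \<sigma> ^ 4 * ((real N)\<^sup>2 + 2 * real l) * b l"
      using pos[of l] by (intro mult_right_mono) (auto simp: algebra_simps)
    then show ?thesis using diag_moment_add_2_ge[OF assms(2), of N l] by (simp add: b_def)
  qed
  have psd: "psd_eigenvalues (moment_matrix N \<sigma> T) (T + 1) lams"
    if "sorted_eigenvalues (moment_matrix N \<sigma> T) lams" for T lams
  proof
    show "moment_matrix N \<sigma> T \<in> carrier_mat (T + 1) (T + 1)" by (simp add: moment_matrix_def)
    show "0 \<le> (\<Sum>i<T + 1. \<Sum>j<T + 1. moment_matrix N \<sigma> T $$ (i, j) * v i * v j)" for v
      by (rule moment_matrix_psd[OF assms(2)])
  qed (use that in \<open>auto intro: moment_matrix_sym\<close>)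
  have trace: "sum_list lams = (\<Sum>l\<le>T. b l)" if "sorted_eigenvalues (moment_matrix N \<sigma> T) lams" for T lams
    using psd_eigenvalues.sum_lams[OF psd[OF that]] moment_matrix_diag[OF assms(2)]
    by (simp add: b_def lessThan_Suc_atMost)
  have trace_pos: "0 < sum_list lams" if "sorted_eigenvalues (moment_matrix N \<sigma> T) lams" for T lams
    unfolding trace[OF that] by (intro sum_pos pos) auto
  have diag_le: "b l \<le> lams ! 0" if "sorted_eigenvalues (moment_matrix N \<sigma> T) lams" "l \<le> T" for T lams l
    using psd_eigenvalues.diag_le_max[OF psd[OF that(1)], of l] moment_matrix_diag[OF assms(2) that(2)] that
    by (simp add: b_def)
  have ratio: "1 / R \<le> lams ! 0 / sum_list lams"
    if "sorted_eigenvalues (moment_matrix N \<sigma> T) lams" "sum_list lams \<le> R * lams ! 0" "R > 0" for R T lams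
    using that trace_pos[OF that(1)] by (simp add: field_simps)
  show ?thesis
  proof (rule conjI)
    show "\<forall>T \<ge> 1. \<forall>lams. sorted_eigenvalues (moment_matrix N \<sigma> T) lams \<longrightarrow>
            1 / P_bound \<sigma> N T \<le> lams ! 0 / sum_list lams \<and> lams ! 0 / sum_list lams \<le> 1"
    proof (intro allI impI conjI)
      fix T :: nat and lams assume T: "T \<ge> 1" and lams: "sorted_eigenvalues (moment_matrix N \<sigma> T) lams"
      show "lams ! 0 / sum_list lams \<le> 1"
        using psd_eigenvalues.max_le_sum[OF psd[OF lams]] trace_pos[OF lams] by simp
      show "1 / P_bound \<sigma> N T \<le> lams ! 0 / sum_list lams"
      proof (rule ratio[OF lams])
        have g: "0 < (\<Sum>l\<le>T. c powi (- int l))" using c by (intro sum_pos) auto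
        then show "P_bound \<sigma> N T > 0" by (simp add: P_bound_def c_def)
        have "sum_list lams \<le> (\<Sum>l\<le>T. c powi (- int l)) * b T"
          unfolding trace[OF lams] using c step by (rule sum_le_geometric_growth)
        also have "\<dots> \<le> (\<Sum>l\<le>T. c powi (- int l)) * lams ! 0"
          using g diag_le[OF lams] by (intro mult_left_mono) auto
        \<comment> \<open>The other entry of the minimum, \<open>T + 1\<close>, is the number of
          eigenvalues, each at most the largest.\<close>
        finally show "sum_list lams \<le> P_bound \<sigma> N T * lams ! 0"
          using psd_eigenvalues.sum_le_card_max[OF psd[OF lams]]
          by (simp add: P_bound_def c_def min_def add.commute)
      qed
    qed
  next
    obtain T0 where T0: "T0 \<ge> 6" and bound: "\<And>T. T \<ge> T0 \<Longrightarrow> (\<Sum>l\<le>T. b l) \<le> min 2 (1 + 1 / c) *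
        (1 + 1 / (2 * \<sigma> ^ 4 * (real T - 3)) + real T / (8 * (\<sigma> ^ 4)\<^sup>2 * (real T - 5)\<^sup>2))
        * max (b T) (b (T - 1))"
      using sum_le_two_step_growth[of b c "\<sigma> ^ 4", OF pos c _ step two_step] assms by auto
    show "\<exists>T0 :: nat. T0 \<ge> 6 \<and> (\<forall>T \<ge> T0. \<forall>lams. sorted_eigenvalues (moment_matrix N \<sigma> T) lams \<longrightarrow>
               1 / Q_bound \<sigma> N T \<le> lams ! 0 / sum_list lams)"
    proof (intro exI[of _ T0] conjI allI impI T0)
      fix T :: nat and lams assume T: "T \<ge> T0" and lams: "sorted_eigenvalues (moment_matrix N \<sigma> T) lams"
      have T6: "T \<ge> 6" using T T0 by simp
      define M where "M = min 2 (1 + 1 / c)"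
      have M: "M > 0" using c by (simp add: M_def add_pos_pos)
      let ?q = "\<lambda>s. 1 + 1 / (2 * s * (real T - 3)) + real T / (8 * s\<^sup>2 * (real T - 5)\<^sup>2)"
      let ?s = "(\<sigma>\<^sup>2 / real N)\<^sup>2"
      have s: "0 < ?s" "?s \<le> \<sigma> ^ 4"
      proof -
        show "0 < ?s" using assms by simp
        have "\<sigma>\<^sup>2 / real N \<le> \<sigma>\<^sup>2"
          using assms by (simp add: divide_le_eq mult_le_cancel_left1)
        then have "?s \<le> (\<sigma>\<^sup>2)\<^sup>2" using assms by (intro power_mono) auto
        then show "?s \<le> \<sigma> ^ 4" by simp
      qed
      \<comment> \<open>The growth argument yields the bound with \<open>\<sigma> ^ 4\<close>; since
        \<open>N \<ge> 1\<close> and \<open>?q\<close> decreases in its argument, the stated bound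
        is weaker.\<close>
      have q: "?q (\<sigma> ^ 4) \<le> ?q ?s"
        using T6 s assms
        by (intro add_mono divide_left_mono mult_right_mono mult_left_mono power_mono mult_pos_pos order_refl) auto
      have q_pos: "0 < ?q ?s" using T6 s by (intro add_pos_nonneg) auto
      have Q: "Q_bound \<sigma> N T = M * ?q ?s"
        by (simp add: Q_bound_def M_def c_def)
      have m: "max (b T) (b (T - 1)) \<le> lams ! 0"
        using diag_le[OF lams] by simp
      show "1 / Q_bound \<sigma> N T \<le> lams ! 0 / sum_list lams"
      proof (rule ratio[OF lams])
        show "Q_bound \<sigma> N T > 0" unfolding Q using M q_pos by (rule mult_pos_pos)
        have "sum_list lams \<le> M * ?q (\<sigma> ^ 4) * max (b T) (b (T - 1))"
          unfolding trace[OF lams] M_def by (rule bound[OF T])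
        also have "\<dots> \<le> M * ?q ?s * lams ! 0"
          by (rule mult_mono[OF mult_left_mono[OF q] m]) (use M q_pos pos[of T] in \<open>auto simp: le_max_iff_disj\<close>)
        finally show "sum_list lams \<le> Q_bound \<sigma> N T * lams ! 0" unfolding Q .
      qed
    qed
  qed
qed

end
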